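(* Let $R$ be a commutative Noetherian ring, let $I \subseteq R$ be an ideal and let $u = \frac{p}{q}$ be a positive rational number. Assume that the following conditions hold: (i) $\mathrm{Ass}(I) = \mathrm{Min}(I)$; and (ii) the associated graded ring $\mathrm{gr}_{I_{\mathfrak p}}(R_{\mathfrak p}) = \bigoplus_{t\ge 0} I_{\mathfrak p}^t/I_{\mathfrak p}^{t+1}$ is reduced for every $\mathfrak p \in \mathrm{Ass}(I)$. Then the $u$-th rational symbolic power $\overline{I^{(u)}}$ of $I$ satisfies $$\overline{I^{(u)}} = I^{(\lceil u\rceil)}.$$
   Context: $\mathrm{Ass}(I)$ denotes $\mathrm{Ass}_R(R/I)$, $\mathrm{Min}(I)$ the set of minimal primes of $I$, and $I_{\mathfrak p}=IR_{\mathfrak p}$. $\lceil u\rceil$ is the smallest positive integer $t$ with $t\ge u$. For an ideal $J$, $\overline J$ denotes its integral closure. For $u=\frac pq$ ($p,q$ positive integers), the $u$-th rational power of $I$ is $\overline{I^u}=\{f\in R \mid f^q\in \overline{I^p}\}$ ($\overline{I^p}$ being the integral closure of $I^p$), independent of the presentation of $u$. The $u$-th rational symbolic power of $I$ is $\overline{I^{(u)}}=\bigcap_{\mathfrak p\in \mathrm{Ass}(I)}(\overline{I^u}R_{\mathfrak p}\cap R)$; in this statement $\overline{I^{(u)}}$ always has this meaning, also for integer $u$. For a positive integer $m$, the symbolic power is $I^{(m)}=\bigcap_{\mathfrak p\in\mathrm{Ass}(I)}(I^mR_{\mathfrak p}\cap R)$. Here $JR_{\mathfrak p}\cap R$ denotes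 the preimage of $JR_{\mathfrak p}$ under $R\to R_{\mathfrak p}$. *)

theory Defs
  imports "HOL-Algebra.Algebra"
begin

section \<open>Associated and minimal primes\<close>

text \<open>The quotient ring \<open>R Quot I\<close> regarded as an \<open>R\<close>-module.\<close>

definition quot_module :: "('a, 'b) ring_scheme \<Rightarrow> 'a set \<Rightarrow> ('a, 'a set) module"
  where "quot_module R I =
    \<lparr> carrier = carrier (R Quot I),
      monoid.mult = monoid.mult (R Quot I),
      one = one (R Quot I),
      ring.zero = ring.zero (R Quot I),
      ring.add = ring.add (R Quot I),
      smult = (\<lambda>r A. (I +>\<^bsub>R\<^esub> r) \<otimes>\<^bsub>R Quot I\<^esub> A) \<rparr>"

definition annihilator :: "('a, 'b) ring_scheme \<Rightarrow> ('a, 'c, 'd) module_scheme \<Rightarrow> 'c \<Rightarrow> 'a set"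
  where "annihilator R M x = {r \<in> carrier R. r \<odot>\<^bsub>M\<^esub> x = \<zero>\<^bsub>M\<^esub>}"

definition associated_primes :: "('a, 'b) ring_scheme \<Rightarrow> ('a, 'c, 'd) module_scheme \<Rightarrow> 'a set set"
  where "associated_primes R M = {P. primeideal P R \<and> (\<exists>x \<in> carrier M. P = annihilator R M x)}"

definition Ass :: "('a, 'b) ring_scheme \<Rightarrow> 'a set \<Rightarrow> 'a set set"
  where "Ass R I = associated_primes R (quot_module R I)"

definition minimal_primes :: "('a, 'b) ring_scheme \<Rightarrow> 'a set \<Rightarrow> 'a set set"
  where "minimal_primes R I =
    {P. primeideal P R \<and> I \<subseteq> P \<and> (\<forall>Q. primeideal Q R \<and> I \<subseteq> Q \<and> Q \<subseteq> P \<longrightarrow> Q = P)}"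


section \<open>Localization\<close>

definition fraction_rel :: "('a, 'b) ring_scheme \<Rightarrow> 'a set \<Rightarrow> ('a \<times> 'a) rel"
  where "fraction_rel R S =
    {((a, s), (b, t)). a \<in> carrier R \<and> b \<in> carrier R \<and> s \<in> S \<and> t \<in> S \<and>
       (\<exists>v \<in> S. v \<otimes>\<^bsub>R\<^esub> ((t \<otimes>\<^bsub>R\<^esub> a) \<ominus>\<^bsub>R\<^esub> (s \<otimes>\<^bsub>R\<^esub> b)) = \<zero>\<^bsub>R\<^esub>)}"

text \<open>The fraction \<open>a / s\<close>, i.e. the equivalence class of \<open>(a, s)\<close>.\<close>

definition fraction :: "('a, 'b) ring_scheme \<Rightarrow> 'a set \<Rightarrow> 'a \<Rightarrow> 'a \<Rightarrow> ('a \<times> 'a) set"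
  where "fraction R S a s = fraction_rel R S `` {(a, s)}"

text \<open>
  The ring of fractions for a multiplicative set \<open>S\<close>. As with \<^const>\<open>rcoset_mult\<close>, an operation on
  classes is the union of its results on all representatives; these results coincide.
\<close>

definition ring_of_fractions :: "('a, 'b) ring_scheme \<Rightarrow> 'a set \<Rightarrow> ('a \<times> 'a) set ring"
  where "ring_of_fractions R S =
    \<lparr> carrier = (carrier R \<times> S) // fraction_rel R S,
      monoid.mult = (\<lambda>A B. \<Union>(a, s) \<in> A. \<Union>(b, t) \<in> B. fraction R S (a \<otimes>\<^bsub>R\<^esub> b) (s \<otimes>\<^bsub>R\<^esub> t)),
      one = fraction R S \<one>\<^bsub>R\<^esub> \<one>\<^bsub>R\<^esub>,
      ring.zero = fraction R S \<zero>\<^bsub>R\<^esub> \<one>\<^bsub>R\<^esub>,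
      ring.add = (\<lambda>A B. \<Union>(a, s) \<in> A. \<Union>(b, t) \<in> B.
               fraction R S ((t \<otimes>\<^bsub>R\<^esub> a) \<oplus>\<^bsub>R\<^esub> (s \<otimes>\<^bsub>R\<^esub> b)) (s \<otimes>\<^bsub>R\<^esub> t)) \<rparr>"

definition localization :: "('a, 'b) ring_scheme \<Rightarrow> 'a set \<Rightarrow> ('a \<times> 'a) set ring"
  where "localization R P = ring_of_fractions R (carrier R - P)"

definition localization_map :: "('a, 'b) ring_scheme \<Rightarrow> 'a set \<Rightarrow> 'a \<Rightarrow> ('a \<times> 'a) set"
  where "localization_map R P a = fraction R (carrier R - P) a \<one>\<^bsub>R\<^esub>"

text \<open>\<open>J R\<^sub>P\<close> and its preimage \<open>J R\<^sub>P \<inter> R\<close> in \<open>R\<close>.\<close>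

definition localized_ideal :: "('a, 'b) ring_scheme \<Rightarrow> 'a set \<Rightarrow> 'a set \<Rightarrow> ('a \<times> 'a) set set"
  where "localized_ideal R P J = Idl\<^bsub>localization R P\<^esub> (localization_map R P ` J)"

definition localized_ideal_preimage :: "('a, 'b) ring_scheme \<Rightarrow> 'a set \<Rightarrow> 'a set \<Rightarrow> 'a set"
  where "localized_ideal_preimage R P J =
    {f \<in> carrier R. localization_map R P f \<in> localized_ideal R P J}"


section \<open>Powers of ideals and integral closure\<close>

text \<open>Powers in the multiplicative monoid of ideals; in particular \<open>ideal_power R I 0 = carrier R\<close>.\<close>

definition ideal_power :: "('a, 'b) ring_scheme \<Rightarrow> 'a set \<Rightarrow> nat \<Rightarrow> 'a set"
  where "ideal_power R I n = I [^]\<^bsub>ideals_set R\<^esub> n"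

definition integral_over_ideal :: "('a, 'b) ring_scheme \<Rightarrow> 'a set \<Rightarrow> 'a \<Rightarrow> bool"
  where "integral_over_ideal R J f \<longleftrightarrow>
    (\<exists>n > 0. \<exists>a :: nat \<Rightarrow> 'a. (\<forall>i \<in> {1..n}. a i \<in> ideal_power R J i) \<and>
       f [^]\<^bsub>R\<^esub> n \<oplus>\<^bsub>R\<^esub> (\<Oplus>\<^bsub>R\<^esub>i \<in> {1..n}. a i \<otimes>\<^bsub>R\<^esub> f [^]\<^bsub>R\<^esub> (n - i)) = \<zero>\<^bsub>R\<^esub>)"

definition integral_closure :: "('a, 'b) ring_scheme \<Rightarrow> 'a set \<Rightarrow> 'a set"
  where "integral_closure R J = {f \<in> carrier R. integral_over_ideal R J f}"

text \<open>
  The \<open>u\<close>-th rational power for \<open>u = p / q\<close>, taken as a function of the presentation \<open>(p, q)\<close>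
  (\<open>p, q > 0\<close>); its value depends only on \<open>u\<close>.
\<close>

definition rational_power :: "('a, 'b) ring_scheme \<Rightarrow> 'a set \<Rightarrow> nat \<Rightarrow> nat \<Rightarrow> 'a set"
  where "rational_power R I p q =
    {f \<in> carrier R. f [^]\<^bsub>R\<^esub> q \<in> integral_closure R (ideal_power R I p)}"


section \<open>Symbolic powers\<close>

text \<open>The intersections are taken inside \<open>R\<close>: they equal \<open>R\<close> if \<open>Ass R I\<close> is empty, i.e. \<open>I = R\<close>.\<close>

definition symbolic_power :: "('a, 'b) ring_scheme \<Rightarrow> 'a set \<Rightarrow> nat \<Rightarrow> 'a set"
  where "symbolic_power R I m =
    carrier R \<inter> (\<Inter>P \<in> Ass R I. localized_ideal_preimage R P (ideal_power R I m))"

definition rational_symbolic_power :: "('a, 'b) ring_scheme \<Rightarrow> 'a set \<Rightarrow> nat \<Rightarrow> nat \<Rightarrow> 'a set"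
  where "rational_symbolic_power R I p q =
    carrier R \<inter> (\<Inter>P \<in> Ass R I. localized_ideal_preimage R P (rational_power R I p q))"


section \<open>The associated graded ring\<close>

text \<open>
  The summand \<open>I\<^sup>t / I\<^sup>t\<^sup>+\<^sup>1\<close>, as the set of those cosets of \<open>I\<^sup>t\<^sup>+\<^sup>1\<close> in \<open>R\<close> that are
  represented by elements of \<open>I\<^sup>t\<close>.
\<close>

definition gr_component :: "('a, 'b) ring_scheme \<Rightarrow> 'a set \<Rightarrow> nat \<Rightarrow> 'a set set"
  where "gr_component R I t = (\<lambda>x. ideal_power R I (Suc t) +>\<^bsub>R\<^esub> x) ` ideal_power R I t"

text \<open>
  Elements of the direct sum are finitely supported families. The product of \<open>A \<in> I\<^sup>i / I\<^sup>i\<^sup>+\<^sup>1\<close>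
  and \<open>B \<in> I\<^sup>j / I\<^sup>j\<^sup>+\<^sup>1\<close> is the coset of \<open>I\<^sup>i\<^sup>+\<^sup>j\<^sup>+\<^sup>1\<close> containing all products of representatives,
  which is \<open>rcoset_mult R (ideal_power R I (Suc (i + j))) A B\<close>; sums in degree \<open>n\<close> are formed in
  \<open>R / I\<^sup>n\<^sup>+\<^sup>1\<close>, which contains \<open>I\<^sup>n / I\<^sup>n\<^sup>+\<^sup>1\<close>.
\<close>

definition associated_graded_ring :: "('a, 'b) ring_scheme \<Rightarrow> 'a set \<Rightarrow> (nat \<Rightarrow> 'a set) ring"
  where "associated_graded_ring R I =
    \<lparr> carrier = {x. (\<forall>t. x t \<in> gr_component R I t) \<and> finite {t. x t \<noteq> ideal_power R I (Suc t)}},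
      monoid.mult = (\<lambda>x y n. \<Oplus>\<^bsub>R Quot ideal_power R I (Suc n)\<^esub>i \<in> {..n}.
                rcoset_mult R (ideal_power R I (Suc n)) (x i) (y (n - i))),
      one = (\<lambda>t. if t = 0 then ideal_power R I (Suc 0) +>\<^bsub>R\<^esub> \<one>\<^bsub>R\<^esub> else ideal_power R I (Suc t)),
      ring.zero = (\<lambda>t. ideal_power R I (Suc t)),
      ring.add = (\<lambda>x y t. x t <+>\<^bsub>R\<^esub> y t) \<rparr>"

definition reduced_ring :: "('a, 'b) ring_scheme \<Rightarrow> bool"
  where "reduced_ring R \<longleftrightarrow> (\<forall>x \<in> carrier R. \<forall>n::nat. x [^]\<^bsub>R\<^esub> n = \<zero>\<^bsub>R\<^esub> \<longrightarrow> x = \<zero>\<^bsub>R\<^esub>)"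

end

theory Submission
  imports Defs
begin

text \<open>
  The argument is a comparison of \<open>J\<close>-adic orders. Let \<open>J\<close> be an ideal of a commutative ring \<open>A\<close>
  whose associated graded ring is reduced. If \<open>f\<close> has order exactly \<open>t\<close>, that is
  \<open>f \<in> J\<^sup>t - J\<^sup>t\<^sup>+\<^sup>1\<close>, then its initial form in \<open>J\<^sup>t / J\<^sup>t\<^sup>+\<^sup>1\<close> is not zero, so no power of that form
  is zero: \<open>f\<^sup>k\<close> has order exactly \<open>t k\<close> (\<open>reduced_gr_imp_order_pow\<close>). Suppose now that \<open>f\<^sup>q\<close> is
  integral over \<open>J\<^sup>p\<close> and \<open>t q < p\<close>. In an equation of integral dependence of degree \<open>n\<close> for
  \<open>f\<^sup>q\<close>, every term other than \<open>f\<^sup>q\<^sup>n\<close> has order greater than \<open>t q n\<close>, hence so has \<open>f\<^sup>q\<^sup>n\<close>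
  (\<open>integral_imp_pow_mem\<close>), which is a contradiction. So the order of \<open>f\<close> is never a \<open>t\<close> with
  \<open>t q < p\<close>, and climbing through \<open>A = J\<^sup>0, J\<^sup>1, J\<^sup>2, ...\<close> gives \<open>f \<in> J\<^sup>c\<close> for \<open>c = \<lceil>p / q\<rceil>\<close>
  (\<open>rational_power_subset_ideal_power\<close>). An \<open>f\<close> of infinite order lies in \<open>J\<^sup>c\<close> in any case.

  For the theorem, \<open>A\<close> is \<open>R\<^sub>P\<close> and \<open>J = I R\<^sub>P\<close>. Equations of integral dependence are carried along
  \<open>R \<rightarrow> R\<^sub>P\<close>, so the rational power of \<open>I\<close> is mapped into that of \<open>I R\<^sub>P\<close> (\<open>hom_rational_power\<close>) and
  thus into \<open>(I R\<^sub>P)\<^sup>c\<close>, which is contained in \<open>I\<^sup>c R\<^sub>P\<close> (\<open>ideal_power_extension_subset\<close>).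
  Conversely \<open>I\<^sup>c\<close> lies in the rational power already in \<open>R\<close>, since \<open>c q \<ge> p\<close>. The two ideals
  therefore have the same extension to \<open>R\<^sub>P\<close> for every associated prime \<open>P\<close>
  (\<open>localized_rational_power\<close>), and the two symbolic powers are intersections of the contractions
  of these extensions.
\<close>

section \<open>Powers of an ideal\<close>

context cring
begin

lemma ideal_power_0: "ideal_power R J 0 = carrier R"
  by (simp add: ideal_power_def ideals_set_def)

lemma ideal_power_Suc: "ideal_power R J (Suc n) = ideal_prod R (ideal_power R J n) J"
  by (simp add: ideal_power_def ideals_set_def)

lemma ideal_ideal_power:
  assumes "ideal J R"
  shows "ideal (ideal_power R J n) R"
  by (induction n) (simp_all add: ideal_power_0 ideal_power_Suc oneideal ideal_prod_is_ideal assms)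

lemma ideal_power_closed:
  assumes "ideal J R" "x \<in> ideal_power R J n"
  shows "x \<in> carrier R"
  using ideal.Icarr[OF ideal_ideal_power[OF assms(1)] assms(2)] .

lemma ideal_power_add:
  assumes "ideal J R"
  shows "ideal_power R J (m + n) = ideal_prod R (ideal_power R J m) (ideal_power R J n)"
proof (induction n)
  case 0
  show ?case by (simp add: ideal_power_0 ideal_prod_one ideal_ideal_power assms)
next
  case (Suc n)
  then show ?case
    by (simp add: ideal_power_Suc ideal_prod_assoc ideal_ideal_power assms)
qed

lemma ideal_power_power:
  assumes "ideal J R"
  shows "ideal_power R (ideal_power R J m) n = ideal_power R J (m * n)"
proof (induction n)
  case 0
  show ?case by (simp add: ideal_power_0)
next
  case (Suc n)
  have "m * Suc n = m * n + m" by simp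
  with Suc show ?case
    by (simp only: ideal_power_Suc ideal_power_add[OF assms])
qed

lemma ideal_power_mult_mem:
  assumes "ideal J R" "x \<in> ideal_power R J m" "y \<in> ideal_power R J n"
  shows "x \<otimes> y \<in> ideal_power R J (m + n)"
  using assms by (simp add: ideal_power_add ideal_prod.prod)

lemma ideal_power_antimono:
  assumes "ideal J R" "m \<le> n"
  shows "ideal_power R J n \<subseteq> ideal_power R J m"
proof -
  obtain k where "n = m + k"
    using assms(2) le_Suc_ex by blast
  then show ?thesis
    using ideal_prod_inter[OF ideal_ideal_power[OF assms(1)] ideal_ideal_power[OF assms(1)]]
    by (auto simp: ideal_power_add assms(1))
qed

lemma nat_pow_mem_ideal_power:
  assumes "ideal J R" "x \<in> ideal_power R J m"
  shows "x [^] k \<in> ideal_power R J (m * k)"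
proof (induction k)
  case 0
  then show ?case by (simp add: ideal_power_0)
next
  case (Suc k)
  then show ?case
    using ideal_power_mult_mem[OF assms(1) Suc assms(2)] by (simp add: add.commute)
qed

lemma zero_mem_ideal:
  assumes "ideal K R"
  shows "\<zero> \<in> K"
  using assms additive_subgroup.zero_closed ideal.axioms(1) by blast

lemma finsum_mem_ideal:
  assumes "ideal K R" "finite A" "\<And>i. i \<in> A \<Longrightarrow> g i \<in> K"
  shows "finsum R g A \<in> K"
  using assms(2,3)
proof (induction A rule: finite_induct)
  case empty
  then show ?case by (simp add: zero_mem_ideal assms(1))
next
  case (insert x F)
  have g: "g i \<in> carrier R" if "i \<in> insert x F" for i
    using ideal.Icarr[OF assms(1) insert.prems[OF that]] .
  have "finsum R g (insert x F) = g x \<oplus> finsum R g F"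
    using insert.hyps g by (intro finsum_insert) auto
  moreover have "g x \<in> K" "finsum R g F \<in> K"
    using insert.prems insert.IH by auto
  ultimately show ?case
    using additive_subgroup.a_closed[OF ideal.axioms(1)[OF assms(1)]] by simp
qed


section \<open>Homogeneous elements of the associated graded ring\<close>

text \<open>
  For \<open>f \<in> J\<^sup>t\<close> this is the class of \<open>f\<close> in degree \<open>t\<close>. It is zero when \<open>f \<in> J\<^sup>t\<^sup>+\<^sup>1\<close>, so that
  it is the usual initial form only for \<open>f\<close> of order \<open>t\<close>; keeping \<open>t\<close> as an argument makes
  it multiplicative without exceptions. The components in the other degrees are written as the
  coset of \<open>\<zero>\<close>, which allows products of components to be computed uniformly.
\<close>

definition initial_form :: "'a set \<Rightarrow> nat \<Rightarrow> 'a \<Rightarrow> nat \<Rightarrow> 'a set"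
  where "initial_form J t f = (\<lambda>s. ideal_power R J (Suc s) +> (if s = t then f else \<zero>))"

lemma coset_eq_ideal_iff:
  assumes "ideal K R" "x \<in> carrier R"
  shows "K +> x = K \<longleftrightarrow> x \<in> K"
proof -
  have "subgroup K (add_monoid R)"
    using assms(1) by (simp add: additive_subgroup.a_subgroup ideal.axioms(1))
  then show ?thesis
    using assms(2) a_coset_join1 a_coset_join2 by blast
qed

lemma coset_zero:
  assumes "ideal K R"
  shows "K +> \<zero> = K"
  using assms by (simp add: coset_eq_ideal_iff zero_mem_ideal)

lemma coset_eqI:
  assumes "ideal K R" "x \<in> carrier R" "h \<in> K"
  shows "K +> (h \<oplus> x) = K +> x"
proof -
  interpret K: ideal K R by fact
  have "h \<oplus> x \<in> K +> x"
    using assms by (auto simp: a_r_coset_def r_coset_def)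
  then show ?thesis
    by (rule K.a_repr_independence'[symmetric]) fact
qed

text \<open>
  The two factors and the product are cosets of three ideals, of which the third is the smallest.
  Still, for \<open>a = h + f\<close> and \<open>b = k + g\<close> in the two factors one has
  \<open>a b = (h b + f k) + f g\<close>, where \<open>h b\<close> and \<open>f k\<close> lie in \<open>J\<^sup>i\<^sup>+\<^sup>j\<^sup>+\<^sup>1\<close>; all products of representatives thus give the same coset.
\<close>

lemma rcoset_mult_ideal_power:
  assumes J: "ideal J R" and f: "f \<in> ideal_power R J i" and g: "g \<in> ideal_power R J j"
  shows "rcoset_mult R (ideal_power R J (Suc (i + j)))
      (ideal_power R J (Suc i) +> f) (ideal_power R J (Suc j) +> g)
    = ideal_power R J (Suc (i + j)) +> (f \<otimes> g)"
proof -
  let ?K = "ideal_power R J (Suc (i + j))"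
  note id = ideal_ideal_power[OF J]
  interpret Ki: ideal "ideal_power R J (Suc i)" R by (rule id)
  interpret Kj: ideal "ideal_power R J (Suc j)" R by (rule id)
  interpret K: ideal ?K R by (rule id)
  note fg = f[THEN ideal_power_closed[OF J]] g[THEN ideal_power_closed[OF J]]
  have eq: "?K +> (a \<otimes> b) = ?K +> (f \<otimes> g)"
    if a: "a \<in> ideal_power R J (Suc i) +> f" and b: "b \<in> ideal_power R J (Suc j) +> g" for a b
  proof -
    obtain h k where h: "h \<in> ideal_power R J (Suc i)" "a = h \<oplus> f"
      and k: "k \<in> ideal_power R J (Suc j)" "b = k \<oplus> g"
      using a b by (auto simp: a_r_coset_def r_coset_def)
    note hk = Ki.Icarr[OF h(1)] Kj.Icarr[OF k(1)]
    have b': "b \<in> ideal_power R J j"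
      using k g ideal_power_antimono[OF J, of j "Suc j"] id[of j]
      by (auto simp: additive_subgroup.a_closed ideal.axioms(1))
    have 1: "h \<otimes> b \<in> ?K" using ideal_power_mult_mem[OF J h(1) b'] by simp
    have 2: "f \<otimes> k \<in> ?K" using ideal_power_mult_mem[OF J f k(1)] by simp
    have "a \<otimes> b = (h \<otimes> b \<oplus> f \<otimes> k) \<oplus> f \<otimes> g"
      using h(2) k(2) hk fg by (simp add: l_distr r_distr a_ac)
    then show ?thesis
      using coset_eqI[OF id, of "f \<otimes> g"] 1 2 fg by simp
  qed
  have "f \<in> ideal_power R J (Suc i) +> f" "g \<in> ideal_power R J (Suc j) +> g"
    using fg Ki.a_rcos_self Kj.a_rcos_self by auto
  then show ?thesis
    unfolding rcoset_mult_def using eq by blast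
qed

lemma initial_form_carrier:
  assumes J: "ideal J R" and f: "f \<in> ideal_power R J t"
  shows "initial_form J t f \<in> carrier (associated_graded_ring R J)"
proof -
  note id = ideal_ideal_power[OF J]
  have "(if s = t then f else \<zero>) \<in> ideal_power R J s" for s
    using f zero_mem_ideal[OF id] by simp
  moreover have "finite {s. initial_form J t f s \<noteq> ideal_power R J (Suc s)}"
    by (rule finite_subset[of _ "{t}"])
      (auto simp: initial_form_def coset_zero id)
  ultimately show ?thesis
    by (auto simp: associated_graded_ring_def gr_component_def initial_form_def)
qed

lemma initial_form_eq_zero_iff:
  assumes J: "ideal J R" and f: "f \<in> ideal_power R J t"
  shows "initial_form J t f = \<zero>\<^bsub>associated_graded_ring R J\<^esub> \<longleftrightarrow> f \<in> ideal_power R J (Suc t)"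
proof -
  note id = ideal_ideal_power[OF J]
  show ?thesis
    using f[THEN ideal_power_closed[OF J]]
    by (auto simp: associated_graded_ring_def initial_form_def fun_eq_iff
        coset_eq_ideal_iff[OF id] zero_mem_ideal[OF id])
qed

text \<open>
  In degree \<open>n\<close> of the product only the summand with \<open>i = a\<close> and \<open>n - i = b\<close> can be nonzero, which
  forces \<open>n = a + b\<close>.
\<close>

lemma initial_form_mult:
  assumes J: "ideal J R" and f: "f \<in> ideal_power R J a" and g: "g \<in> ideal_power R J b"
  shows "initial_form J a f \<otimes>\<^bsub>associated_graded_ring R J\<^esub> initial_form J b g
    = initial_form J (a + b) (f \<otimes> g)"
proof
  fix n
  let ?K = "ideal_power R J (Suc n)"
  let ?f = "\<lambda>i. if i = a then f else \<zero>" and ?g = "\<lambda>j. if j = b then g else \<zero>"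
  let ?c = "?K +> (if n = a + b then f \<otimes> g else \<zero>)"
  note id = ideal_ideal_power[OF J]
  note fg = f[THEN ideal_power_closed[OF J]] g[THEN ideal_power_closed[OF J]]
  interpret K: ideal ?K R by (rule id)
  interpret Q: ring "R Quot ?K" by (rule K.quotient_is_ring)
  have zero: "\<zero>\<^bsub>R Quot ?K\<^esub> = ?K +> \<zero>"
    by (simp add: FactRing_def coset_zero[OF id])
  have summand: "rcoset_mult R ?K (initial_form J a f i) (initial_form J b g (n - i))
      = (if a = i then ?c else \<zero>\<^bsub>R Quot ?K\<^esub>)" if "i \<le> n" for i
  proof -
    have "?f i \<in> ideal_power R J i" "?g (n - i) \<in> ideal_power R J (n - i)"
      using f g zero_mem_ideal[OF id] by auto
    then have "rcoset_mult R ?K (initial_form J a f i) (initial_form J b g (n - i))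
        = ?K +> (?f i \<otimes> ?g (n - i))"
      using rcoset_mult_ideal_power[OF J, of "?f i" i "?g (n - i)" "n - i"] that
      by (simp add: initial_form_def)
    also have "\<dots> = (if a = i then ?c else \<zero>\<^bsub>R Quot ?K\<^esub>)"
      using that fg zero by auto
    finally show ?thesis .
  qed
  have hQ: "?c \<in> carrier (R Quot ?K)"
    using fg by (auto simp: FactRing_def intro!: a_rcosetsI)
  have "(initial_form J a f \<otimes>\<^bsub>associated_graded_ring R J\<^esub> initial_form J b g) n
      = (\<Oplus>\<^bsub>R Quot ?K\<^esub>i \<in> {..n}. if a = i then ?c else \<zero>\<^bsub>R Quot ?K\<^esub>)"
    unfolding associated_graded_ring_def monoid.simps
  proof (rule Q.finsum_cong'[OF refl Pi_I])
    fix i assume i: "i \<in> {..n}"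
    show "(if a = i then ?c else \<zero>\<^bsub>R Quot ?K\<^esub>) \<in> carrier (R Quot ?K)"
      using hQ Q.zero_closed by (cases "a = i") (simp_all only: if_True if_False simp_thms)
    show "rcoset_mult R ?K (initial_form J a f i) (initial_form J b g (n - i))
        = (if a = i then ?c else \<zero>\<^bsub>R Quot ?K\<^esub>)"
      using i by (intro summand) simp
  qed
  \<comment> \<open>If \<open>n < a\<close>, the index \<open>a\<close> is outside the range of summation, but then \<open>?c\<close> is zero as well.\<close>
  also have "\<dots> = ?c"
  proof (cases "a \<le> n")
    case True
    then show ?thesis
      using hQ by (intro Q.finsum_singleton) auto
  next
    case False
    then have "(\<Oplus>\<^bsub>R Quot ?K\<^esub>i \<in> {..n}. if a = i then ?c else \<zero>\<^bsub>R Quot ?K\<^esub>)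
        = (\<Oplus>\<^bsub>R Quot ?K\<^esub>i \<in> {..n}. \<zero>\<^bsub>R Quot ?K\<^esub>)"
      by (intro Q.finsum_cong') auto
    also have "\<dots> = \<zero>\<^bsub>R Quot ?K\<^esub>"
      by (rule Q.finsum_zero)
    also have "\<dots> = ?c"
      using False zero by simp
    finally show ?thesis .
  qed
  also have "\<dots> = initial_form J (a + b) (f \<otimes> g) n"
    by (simp add: initial_form_def)
  finally show "(initial_form J a f \<otimes>\<^bsub>associated_graded_ring R J\<^esub> initial_form J b g) n
    = initial_form J (a + b) (f \<otimes> g) n" .
qed

lemma initial_form_pow:
  assumes J: "ideal J R" and f: "f \<in> ideal_power R J t"
  shows "initial_form J t f [^]\<^bsub>associated_graded_ring R J\<^esub> (k::nat)
    = initial_form J (t * k) (f [^] k)"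
proof (induction k)
  case 0
  show ?case
    using ideal_ideal_power[OF J]
    by (auto simp: associated_graded_ring_def initial_form_def fun_eq_iff
coset_zero)
next
  case (Suc k)
  then show ?case
    using initial_form_mult[OF J nat_pow_mem_ideal_power[OF J f, of k] f]
    by (simp add: add.commute)
qed

text \<open>
  The hypothesis says that the degree \<open>t k\<close> component of the \<open>k\<close>-th power of the initial form of
  \<open>f\<close> vanishes; this power is homogeneous, so it is zero, and by reducedness the initial form is
  zero.
\<close>

lemma reduced_gr_imp_order_pow:
  assumes J: "ideal J R" and red: "reduced_ring (associated_graded_ring R J)"
    and f: "f \<in> ideal_power R J t" and fk: "f [^] (k::nat) \<in> ideal_power R J (Suc (t * k))"
  shows "f \<in> ideal_power R J (Suc t)"
proof -
  have "initial_form J t f [^]\<^bsub>associated_graded_ring R J\<^esub> k = \<zero>\<^bsub>associated_graded_ring R J\<^esub>"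
    using initial_form_pow[OF J f] fk
      initial_form_eq_zero_iff[OF J nat_pow_mem_ideal_power[OF J f, of k]] by simp
  then have "initial_form J t f = \<zero>\<^bsub>associated_graded_ring R J\<^esub>"
    using red initial_form_carrier[OF J f] unfolding reduced_ring_def by blast
  then show ?thesis
    using initial_form_eq_zero_iff[OF J f] by simp
qed


section \<open>Rational powers\<close>

text \<open>
  In \<open>g\<^sup>n + a\<^sub>1 g\<^sup>n\<^sup>-\<^sup>1 + ... + a\<^sub>n = 0\<close> with \<open>a\<^sub>i \<in> J\<^sup>p\<^sup>i\<close>, the term with index \<open>i \<ge> 1\<close> lies in
  \<open>J\<close> to the power \<open>p i + s (n - i)\<close>. This exponent is at least \<open>s n + i\<close>, because \<open>p \<ge> s + 1\<close>.
  The strict gain in every lower term is passed on to \<open>g\<^sup>n\<close>.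
\<close>

lemma integral_imp_pow_mem:
  assumes J: "ideal J R" and g: "g \<in> ideal_power R J s" and "s < p"
    and int: "integral_over_ideal R (ideal_power R J p) g"
  shows "\<exists>n. g [^] (n::nat) \<in> ideal_power R J (Suc (s * n))"
proof -
  obtain n :: nat and a where n: "n > 0"
    and a: "\<And>i. i \<in> {1..n} \<Longrightarrow> a i \<in> ideal_power R (ideal_power R J p) i"
    and eq: "g [^] n \<oplus> (\<Oplus>i \<in> {1..n}. a i \<otimes> g [^] (n - i)) = \<zero>"
    using int unfolding integral_over_ideal_def by blast
  let ?K = "ideal_power R J (Suc (s * n))"
  have K: "ideal ?K R" using J by (rule ideal_ideal_power)
  have gc: "g \<in> carrier R" using ideal_power_closed[OF J g] .
  have "a i \<otimes> g [^] (n - i) \<in> ?K" if i: "i \<in> {1..n}" for i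
  proof -
    have "a i \<otimes> g [^] (n - i) \<in> ideal_power R J (p * i + s * (n - i))"
      using ideal_power_mult_mem[OF J _ nat_pow_mem_ideal_power[OF J g]] a[OF i]
      by (simp add: ideal_power_power J)
    moreover have "Suc (s * n) \<le> p * i + s * (n - i)"
    proof -
      have "Suc (s * n) \<le> Suc s * i + s * (n - i)"
        using i by (auto simp: add_mult_distrib2 dest!: le_Suc_ex)
      also have "\<dots> \<le> p * i + s * (n - i)"
        using \<open>s < p\<close> by (intro add_mono mult_le_mono) auto
      finally show ?thesis .
    qed
    ultimately show ?thesis
      using ideal_power_antimono[OF J] by blast
  qed
  then have sum: "(\<Oplus>i \<in> {1..n}. a i \<otimes> g [^] (n - i)) \<in> ?K" (is "?s \<in> _")
    by (intro finsum_mem_ideal[OF K]) auto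
  then have "?s \<in> carrier R" by (rule ideal.Icarr[OF K])
  then have "g [^] n = \<ominus> ?s"
    using eq gc by (simp add: minus_equality[symmetric])
  also have "\<ominus> ?s \<in> ?K"
    using sum K by (simp add: additive_subgroup.a_inv_closed ideal.axioms(1))
  finally show ?thesis by blast
qed

text \<open>
  The condition on \<open>c\<close> says \<open>c \<le> \<lceil>p / q\<rceil>\<close> if \<open>q > 0\<close>. At each level \<open>t < c\<close>, integrality pushes
  some power of \<open>f\<close> one step deeper than \<open>f \<in> J\<^sup>t\<close> accounts for, and reducedness turns this into
  a step for \<open>f\<close> itself.
\<close>

lemma rational_power_subset_ideal_power:
  assumes J: "ideal J R" and red: "reduced_ring (associated_graded_ring R J)"
    and "\<And>t. t < c \<Longrightarrow> t * q < p"
  shows "rational_power R J p q \<subseteq> ideal_power R J c"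
proof
  fix f assume f: "f \<in> rational_power R J p q"
  then have fc: "f \<in> carrier R"
    and int: "integral_over_ideal R (ideal_power R J p) (f [^] q)"
    by (auto simp: rational_power_def integral_closure_def)
  have "t \<le> c \<Longrightarrow> f \<in> ideal_power R J t" for t
  proof (induction t)
    case 0
    then show ?case using fc by (simp add: ideal_power_0)
  next
    case (Suc t)
    then have ft: "f \<in> ideal_power R J t" and "t * q < p"
      using assms(3) by auto
    then obtain n :: nat where "(f [^] q) [^] n \<in> ideal_power R J (Suc (t * q * n))"
      using integral_imp_pow_mem[OF J nat_pow_mem_ideal_power[OF J ft] _ int] by blast
    then have "f [^] (q * n) \<in> ideal_power R J (Suc (t * (q * n)))"
      using fc by (simp add: nat_pow_pow mult.assoc)
    then show ?case
      by (rule reduced_gr_imp_order_pow[OF J red ft])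
  qed
  then show "f \<in> ideal_power R J c" by simp
qed

lemma mem_imp_integral_over_ideal:
  assumes J: "ideal J R" and f: "f \<in> J"
  shows "integral_over_ideal R J f"
proof -
  have fc: "f \<in> carrier R" using f ideal.Icarr[OF J] by blast
  have "\<ominus> f \<in> ideal_power R J 1"
    using f J ideal_power_add[OF J, of 0 1]
    by (simp add: ideal_power_Suc ideal_power_0 ideal_prod_commute[OF oneideal J]
        ideal_prod_one additive_subgroup.a_inv_closed ideal.axioms(1))
  moreover have "f [^] (1::nat) \<oplus> (\<Oplus>i \<in> {1..1::nat}. \<ominus> f \<otimes> f [^] (1 - i)) = \<zero>"
    using fc by (simp add: r_neg)
  ultimately show ?thesis
    unfolding integral_over_ideal_def
    by (intro exI[of _ "1::nat"] conjI exI[of _ "\<lambda>_. \<ominus> f"]) auto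
qed

lemma ideal_power_subset_rational_power:
  assumes J: "ideal J R" and "p \<le> c * q"
  shows "ideal_power R J c \<subseteq> rational_power R J p q"
proof
  fix f assume f: "f \<in> ideal_power R J c"
  then have "f [^] q \<in> ideal_power R J p"
    using nat_pow_mem_ideal_power[OF J f] ideal_power_antimono[OF J assms(2)] by blast
  then show "f \<in> rational_power R J p q"
    using f ideal_power_closed[OF J] mem_imp_integral_over_ideal[OF ideal_ideal_power[OF J]]
    by (auto simp: rational_power_def integral_closure_def)
qed


section \<open>Extension of ideals along ring homomorphisms\<close>

lemma ideal_colon:
  assumes K: "ideal K R" and B: "B \<subseteq> carrier R"
  shows "ideal {x \<in> carrier R. \<forall>b\<in>B. x \<otimes> b \<in> K} R" (is "ideal ?C R")
proof (rule idealI[OF ring_axioms])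
  interpret K: ideal K R by fact
  show "subgroup ?C (add_monoid R)"
    by (unfold_locales)
      (use B in \<open>auto simp: l_distr subset_iff l_minus simp flip: a_inv_def\<close>)
  show "x \<otimes> a \<in> ?C" if "a \<in> ?C" "x \<in> carrier R" for a x
    using that B K.I_l_closed by (auto simp: m_assoc subset_iff)
  then show "a \<otimes> x \<in> ?C" if "a \<in> ?C" "x \<in> carrier R" for a x
    using that by (simp add: m_comm)
qed

text \<open>
  Products of generators suffice because colon ideals are ideals: first \<open>(K : B)\<close> contains \<open>A\<close> and so
  \<open>Idl A\<close>, then \<open>(K : x)\<close> contains \<open>B\<close> and so \<open>Idl B\<close> for each \<open>x \<in> Idl A\<close>.
\<close>

lemma genideal_mult_mem:
  assumes K: "ideal K R" and A: "A \<subseteq> carrier R" and B: "B \<subseteq> carrier R"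
    and AB: "\<And>a b. a \<in> A \<Longrightarrow> b \<in> B \<Longrightarrow> a \<otimes> b \<in> K"
    and x: "x \<in> Idl A" and y: "y \<in> Idl B"
  shows "x \<otimes> y \<in> K"
proof -
  have xB: "x \<otimes> b \<in> K" if "b \<in> B" for b
    using genideal_minimal[OF ideal_colon[OF K B], of A] A AB x that by blast
  have xc: "x \<in> carrier R"
    using ideal.Icarr[OF genideal_ideal[OF A] x] .
  then have "Idl B \<subseteq> {z \<in> carrier R. \<forall>b\<in>{x}. z \<otimes> b \<in> K}"
    using B xB by (intro genideal_minimal ideal_colon[OF K]) (auto simp: m_comm subset_iff)
  then have "y \<in> carrier R" "y \<otimes> x \<in> K" using y by auto
  then show ?thesis using xc by (simp add: m_comm)
qed

end

context ring_hom_cring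
begin

lemma hom_ideal_power:
  assumes I: "ideal I R" and "h ` I \<subseteq> K"
    and "x \<in> ideal_power R I n"
  shows "h x \<in> ideal_power S K n"
  using assms(3)
proof (induction n arbitrary: x)
  case 0
  then show ?case by (simp add: R.ideal_power_0 S.ideal_power_0)
next
  case (Suc n)
  from Suc.prems show ?case
    unfolding R.ideal_power_Suc
  proof (induction x rule: ideal_prod.induct)
    case (prod i j)
    have "i \<in> carrier R" "j \<in> carrier R"
      using prod R.ideal_power_closed[OF I] ideal.Icarr[OF I] by auto
    then show ?case
      using prod Suc.IH assms(2) by (auto simp: S.ideal_power_Suc intro!: ideal_prod.prod)
  next
    case (sum s1 s2)
    have "s1 \<in> carrier R" "s2 \<in> carrier R"
      using sum.hyps R.ideal_prod_in_carrier[OF R.ideal_ideal_power[OF I] I] by auto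
    then show ?case
      using sum.IH by (auto simp: S.ideal_power_Suc intro!: ideal_prod.sum)
  qed
qed

lemma hom_integral_over_ideal:
  assumes I: "ideal I R" and sub: "h ` I \<subseteq> K" and f: "f \<in> carrier R"
    and "integral_over_ideal R I f"
  shows "integral_over_ideal S K (h f)"
proof -
  obtain n :: nat and a where n: "n > 0"
    and a: "\<And>i. i \<in> {1..n} \<Longrightarrow> a i \<in> ideal_power R I i"
    and eq: "f [^]\<^bsub>R\<^esub> n \<oplus>\<^bsub>R\<^esub> (\<Oplus>\<^bsub>R\<^esub>i \<in> {1..n}. a i \<otimes>\<^bsub>R\<^esub> f [^]\<^bsub>R\<^esub> (n - i)) = \<zero>\<^bsub>R\<^esub>"
    using assms(4) unfolding integral_over_ideal_def by blast
  have ac: "a i \<in> carrier R" if "i \<in> {1..n}" for i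
    using a[OF that] R.ideal_power_closed[OF I] by blast
  have "h (\<Oplus>\<^bsub>R\<^esub>i \<in> {1..n}. a i \<otimes>\<^bsub>R\<^esub> f [^]\<^bsub>R\<^esub> (n - i))
      = (\<Oplus>\<^bsub>S\<^esub>i \<in> {1..n}. h (a i) \<otimes>\<^bsub>S\<^esub> h f [^]\<^bsub>S\<^esub> (n - i))"
    using ac f by (subst hom_finsum) (auto intro!: S.finsum_cong' simp: ring_hom_ring.hom_nat_pow)
  moreover have "(\<Oplus>\<^bsub>R\<^esub>i \<in> {1..n}. a i \<otimes>\<^bsub>R\<^esub> f [^]\<^bsub>R\<^esub> (n - i)) \<in> carrier R"
    using ac f by (intro R.finsum_closed) auto
  ultimately have "h f [^]\<^bsub>S\<^esub> n \<oplus>\<^bsub>S\<^esub> (\<Oplus>\<^bsub>S\<^esub>i \<in> {1..n}. h (a i) \<otimes>\<^bsub>S\<^esub> h f [^]\<^bsub>S\<^esub> (n - i)) = \<zero>\<^bsub>S\<^esub>"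
    using arg_cong[OF eq, of h] f by simp
  then show ?thesis
    unfolding integral_over_ideal_def using n hom_ideal_power[OF I sub a]
    by (intro exI[of _ n] conjI exI[of _ "\<lambda>i. h (a i)"]) auto
qed

text \<open>
  Integral dependence is an equation with coefficients in powers of the ideal, and ring homomorphisms
  preserve both.
\<close>

lemma hom_rational_power:
  assumes I: "ideal I R" and sub: "h ` I \<subseteq> K"
    and f: "f \<in> rational_power R I p q"
  shows "h f \<in> rational_power S K p q"
proof -
  have fc: "f \<in> carrier R"
    and int: "integral_over_ideal R (ideal_power R I p) (f [^]\<^bsub>R\<^esub> q)"
    using f by (auto simp: rational_power_def integral_closure_def)
  have "integral_over_ideal S (ideal_power S K p) (h (f [^]\<^bsub>R\<^esub> q))"
    using fc int hom_ideal_power[OF I sub]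
    by (intro hom_integral_over_ideal[OF R.ideal_ideal_power[OF I]]) auto
  then show ?thesis
    using fc by (simp add: rational_power_def integral_closure_def)
qed

lemma ideal_power_extension_subset:
  assumes I: "ideal I R"
  shows "ideal_power S (Idl\<^bsub>S\<^esub> (h ` I)) n \<subseteq> Idl\<^bsub>S\<^esub> (h ` ideal_power R I n)"
proof (induction n)
  case 0
  have sub: "h ` carrier R \<subseteq> carrier S" by auto
  have "\<one>\<^bsub>S\<^esub> \<in> Idl\<^bsub>S\<^esub> (h ` carrier R)"
    using S.genideal_self[OF sub] hom_one R.one_closed by (metis imageI subsetD)
  then show ?case
    using ideal.one_imp_carrier[OF S.genideal_ideal[OF sub]]
    by (simp add: R.ideal_power_0 S.ideal_power_0)
next
  case (Suc n)
  have c: "h ` ideal_power R I k \<subseteq> carrier S" for k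
    using R.ideal_power_closed[OF I] by auto
  have cI: "h ` I \<subseteq> carrier S"
    using ideal.Icarr[OF I] by auto
  let ?K = "Idl\<^bsub>S\<^esub> (h ` ideal_power R I (Suc n))"
  have K: "ideal ?K S" using S.genideal_ideal[OF c] .
  have gen: "a \<otimes>\<^bsub>S\<^esub> b \<in> ?K" if ab: "a \<in> h ` ideal_power R I n" "b \<in> h ` I" for a b
  proof -
    obtain x y where xy: "x \<in> ideal_power R I n" "y \<in> I" "a = h x" "b = h y"
      using ab by auto
    then have "a \<otimes>\<^bsub>S\<^esub> b = h (x \<otimes>\<^bsub>R\<^esub> y)"
      using R.ideal_power_closed[OF I] ideal.Icarr[OF I] by simp
    moreover have "x \<otimes>\<^bsub>R\<^esub> y \<in> ideal_power R I (Suc n)"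
      using xy by (simp add: R.ideal_power_Suc ideal_prod.prod)
    ultimately show ?thesis using S.genideal_self[OF c] by blast
  qed
  show ?case
  proof
    fix z assume "z \<in> ideal_power S (Idl\<^bsub>S\<^esub> (h ` I)) (Suc n)"
    then show "z \<in> ?K"
      unfolding S.ideal_power_Suc
    proof (induction z rule: ideal_prod.induct)
      case (prod i j)
      then show ?case
        using Suc.IH S.genideal_mult_mem[OF K c cI gen] by blast
    next
      case (sum s1 s2)
      then show ?case
        using K by (simp add: additive_subgroup.a_closed ideal.axioms(1))
    qed
  qed
qed

end


section \<open>Rings of fractions\<close>

locale multiplicative_subset = cring R for R (structure) +
  fixes S
  assumes subset: "S \<subseteq> carrier R"
    and one_mem: "\<one> \<in> S"
    and mult_mem: "s \<in> S \<Longrightarrow> t \<in> S \<Longrightarrow> s \<otimes> t \<in> S"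
begin

lemma mem_carrier [simp]: "s \<in> S \<Longrightarrow> s \<in> carrier R"
  using subset by blast

declare one_mem [simp] mult_mem [simp]

text \<open>
  Without the subtraction, transitivity and well-definedness become computations with products,
  which are settled by associativity and commutativity.
\<close>

lemma fraction_rel_iff:
  "((a, s), (b, t)) \<in> fraction_rel R S \<longleftrightarrow>
     a \<in> carrier R \<and> b \<in> carrier R \<and> s \<in> S \<and> t \<in> S \<and> (\<exists>v\<in>S. v \<otimes> (t \<otimes> a) = v \<otimes> (s \<otimes> b))"
proof -
  have "v \<otimes> (t \<otimes> a \<ominus> s \<otimes> b) = \<zero> \<longleftrightarrow> v \<otimes> (t \<otimes> a) = v \<otimes> (s \<otimes> b)"
    if "a \<in> carrier R" "b \<in> carrier R" "s \<in> S" "t \<in> S" "v \<in> S" for v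
  proof -
    have "v \<otimes> (t \<otimes> a \<ominus> s \<otimes> b) = v \<otimes> (t \<otimes> a) \<ominus> v \<otimes> (s \<otimes> b)"
      using that by (simp add: minus_eq r_distr r_minus)
    then show ?thesis
      using that by simp
  qed
  then show ?thesis
    by (auto simp: fraction_rel_def)
qed

lemma equiv_fraction_rel: "equiv (carrier R \<times> S) (fraction_rel R S)"
proof (rule equivI)
  show "fraction_rel R S \<subseteq> (carrier R \<times> S) \<times> (carrier R \<times> S)"
    by (auto simp: fraction_rel_def)
  show "refl_on (carrier R \<times> S) (fraction_rel R S)"
    by (auto simp: refl_on_def fraction_rel_iff intro: one_mem)
  show "sym (fraction_rel R S)"
    by (auto simp: sym_def fraction_rel_iff) metis
  show "trans (fraction_rel R S)"
  proof (rule transI, clarsimp simp: fraction_rel_iff)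
    fix a s b t c u v w
    assume c: "a \<in> carrier R" "b \<in> carrier R" "c \<in> carrier R"
      "s \<in> S" "t \<in> S" "u \<in> S" "v \<in> S" "w \<in> S"
      and v: "v \<otimes> (t \<otimes> a) = v \<otimes> (s \<otimes> b)" and w: "w \<otimes> (u \<otimes> b) = w \<otimes> (t \<otimes> c)"
    have "(v \<otimes> w \<otimes> t) \<otimes> (u \<otimes> a) = (w \<otimes> u) \<otimes> (v \<otimes> (t \<otimes> a))"
      using c by (simp add: m_ac)
    also have "\<dots> = (v \<otimes> s) \<otimes> (w \<otimes> (u \<otimes> b))"
      unfolding v using c by (simp add: m_ac)
    also have "\<dots> = (v \<otimes> w \<otimes> t) \<otimes> (s \<otimes> c)"
      unfolding w using c by (simp add: m_ac)
    finally show "\<exists>v\<in>S. v \<otimes> (u \<otimes> a) = v \<otimes> (s \<otimes> c)"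
      using c by (intro bexI[of _ "v \<otimes> w \<otimes> t"]) auto
  qed
qed

lemma fraction_eq_iff:
  assumes "a \<in> carrier R" "b \<in> carrier R" "s \<in> S" "t \<in> S"
  shows "fraction R S a s = fraction R S b t \<longleftrightarrow> (\<exists>v\<in>S. v \<otimes> (t \<otimes> a) = v \<otimes> (s \<otimes> b))"
  unfolding fraction_def
  using eq_equiv_class_iff[OF equiv_fraction_rel, of "(a, s)" "(b, t)"] assms
  by (simp add: fraction_rel_iff)

lemma fraction_eqI:
  assumes "a \<in> carrier R" "b \<in> carrier R" "s \<in> S" "t \<in> S" "t \<otimes> a = s \<otimes> b"
  shows "fraction R S a s = fraction R S b t"
  using assms by (subst fraction_eq_iff) (auto intro!: bexI[of _ \<one>])

lemma fraction_carrier [simp]: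
  assumes "a \<in> carrier R" "s \<in> S"
  shows "fraction R S a s \<in> carrier (ring_of_fractions R S)"
  using assms by (auto simp: ring_of_fractions_def fraction_def quotient_def)

lemma fraction_cases:
  assumes "x \<in> carrier (ring_of_fractions R S)"
  obtains a s where "a \<in> carrier R" "s \<in> S" "x = fraction R S a s"
  using assms by (auto simp: ring_of_fractions_def fraction_def quotient_def)

text \<open>
  The operations on fractions are unions over all representatives. A union of equal sets over
  a nonempty index set is that common set, so each operation reduces to its well-definedness,
  stated as \<open>F\<close> being constant on pairs of classes.
\<close>

lemma UN_fraction:
  assumes "a \<in> carrier R" "s \<in> S" "b \<in> carrier R" "t \<in> S"
    and "\<And>a' s' b' t'. ((a, s), (a', s')) \<in> fraction_rel R S \<Longrightarrow>
      ((b, t), (b', t')) \<in> fraction_rel R S \<Longrightarrow> F a' s' b' t' = F a s b t"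
  shows "(\<Union>(a', s') \<in> fraction R S a s. \<Union>(b', t') \<in> fraction R S b t. F a' s' b' t') = F a s b t"
proof -
  have "((a, s), (a, s)) \<in> fraction_rel R S" "((b, t), (b, t)) \<in> fraction_rel R S"
    using assms(1-4) by (auto simp: fraction_rel_iff intro: one_mem)
  then show ?thesis
    using assms(5) unfolding fraction_def by fast
qed

lemma fraction_mult:
  assumes c: "a \<in> carrier R" "s \<in> S" "b \<in> carrier R" "t \<in> S"
  shows "fraction R S a s \<otimes>\<^bsub>ring_of_fractions R S\<^esub> fraction R S b t = fraction R S (a \<otimes> b) (s \<otimes> t)"
  unfolding ring_of_fractions_def monoid.simps
proof (rule UN_fraction[OF c], clarsimp simp: fraction_rel_iff)
  fix a' s' b' t' v w
  assume d: "a' \<in> carrier R" "b' \<in> carrier R" "s' \<in> S" "t' \<in> S" "v \<in> S" "w \<in> S"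
    and v: "v \<otimes> (s' \<otimes> a) = v \<otimes> (s \<otimes> a')" and w: "w \<otimes> (t' \<otimes> b) = w \<otimes> (t \<otimes> b')"
  have "(v \<otimes> w) \<otimes> ((s' \<otimes> t') \<otimes> (a \<otimes> b)) = (v \<otimes> (s' \<otimes> a)) \<otimes> (w \<otimes> (t' \<otimes> b))"
    using c d by (simp add: m_ac)
  also have "\<dots> = (v \<otimes> w) \<otimes> ((s \<otimes> t) \<otimes> (a' \<otimes> b'))"
    unfolding v w using c d by (simp add: m_ac)
  finally have "\<exists>v\<in>S. v \<otimes> ((s \<otimes> t) \<otimes> (a' \<otimes> b')) = v \<otimes> ((s' \<otimes> t') \<otimes> (a \<otimes> b))"
    using d by (intro bexI[of _ "v \<otimes> w"]) auto
  then show "fraction R S (a' \<otimes> b') (s' \<otimes> t') = fraction R S (a \<otimes> b) (s \<otimes> t)"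
    using c d by (subst fraction_eq_iff) auto
qed

lemma fraction_add:
  assumes c: "a \<in> carrier R" "s \<in> S" "b \<in> carrier R" "t \<in> S"
  shows "fraction R S a s \<oplus>\<^bsub>ring_of_fractions R S\<^esub> fraction R S b t
    = fraction R S (t \<otimes> a \<oplus> s \<otimes> b) (s \<otimes> t)"
  unfolding ring_of_fractions_def ring.simps
proof (rule UN_fraction[OF c], clarsimp simp: fraction_rel_iff)
  fix a' s' b' t' v w
  assume d: "a' \<in> carrier R" "b' \<in> carrier R" "s' \<in> S" "t' \<in> S" "v \<in> S" "w \<in> S"
    and v: "v \<otimes> (s' \<otimes> a) = v \<otimes> (s \<otimes> a')" and w: "w \<otimes> (t' \<otimes> b) = w \<otimes> (t \<otimes> b')"
  have "(v \<otimes> w) \<otimes> ((s' \<otimes> t') \<otimes> (t \<otimes> a \<oplus> s \<otimes> b))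
      = (w \<otimes> t \<otimes> t') \<otimes> (v \<otimes> (s' \<otimes> a)) \<oplus> (v \<otimes> s \<otimes> s') \<otimes> (w \<otimes> (t' \<otimes> b))"
    using c d by (simp add: m_ac r_distr)
  also have "\<dots> = (v \<otimes> w) \<otimes> ((s \<otimes> t) \<otimes> (t' \<otimes> a' \<oplus> s' \<otimes> b'))"
    unfolding v w using c d by (simp add: m_ac r_distr)
  finally have "\<exists>v\<in>S. v \<otimes> ((s \<otimes> t) \<otimes> (t' \<otimes> a' \<oplus> s' \<otimes> b'))
      = v \<otimes> ((s' \<otimes> t') \<otimes> (t \<otimes> a \<oplus> s \<otimes> b))"
    using d by (intro bexI[of _ "v \<otimes> w"]) auto
  then show "fraction R S (t' \<otimes> a' \<oplus> s' \<otimes> b') (s' \<otimes> t') = fraction R S (t \<otimes> a \<oplus> s \<otimes> b) (s \<otimes> t)"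
    using c d by (subst fraction_eq_iff) auto
qed

lemma fraction_one: "\<one>\<^bsub>ring_of_fractions R S\<^esub> = fraction R S \<one> \<one>"
  and fraction_zero: "\<zero>\<^bsub>ring_of_fractions R S\<^esub> = fraction R S \<zero> \<one>"
  by (simp_all add: ring_of_fractions_def)

lemma cring_ring_of_fractions: "cring (ring_of_fractions R S)"
proof (rule cringI)
  let ?F = "ring_of_fractions R S"
  show "abelian_group ?F"
  proof (rule abelian_groupI)
    fix x y assume "x \<in> carrier ?F" "y \<in> carrier ?F"
    then show "x \<oplus>\<^bsub>?F\<^esub> y \<in> carrier ?F"
      by (elim fraction_cases) (simp add: fraction_add)
  next
    show "\<zero>\<^bsub>?F\<^esub> \<in> carrier ?F" by (simp add: fraction_zero)
  next
    fix x y z assume "x \<in> carrier ?F" "y \<in> carrier ?F" "z \<in> carrier ?F"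
    then show "x \<oplus>\<^bsub>?F\<^esub> y \<oplus>\<^bsub>?F\<^esub> z = x \<oplus>\<^bsub>?F\<^esub> (y \<oplus>\<^bsub>?F\<^esub> z)"
      by (elim fraction_cases) (simp add: fraction_add m_ac r_distr a_ac)
  next
    fix x y assume "x \<in> carrier ?F" "y \<in> carrier ?F"
    then show "x \<oplus>\<^bsub>?F\<^esub> y = y \<oplus>\<^bsub>?F\<^esub> x"
      by (elim fraction_cases) (simp add: fraction_add m_ac a_ac)
  next
    fix x assume "x \<in> carrier ?F"
    then show "\<zero>\<^bsub>?F\<^esub> \<oplus>\<^bsub>?F\<^esub> x = x"
      by (elim fraction_cases) (simp add: fraction_add fraction_zero)
  next
    fix x assume "x \<in> carrier ?F"
    then obtain a s where x: "a \<in> carrier R" "s \<in> S" "x = fraction R S a s"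
      by (rule fraction_cases)
    have "fraction R S (\<ominus> a) s \<oplus>\<^bsub>?F\<^esub> x = \<zero>\<^bsub>?F\<^esub>"
      using x by (simp add: fraction_add fraction_zero)
        (rule fraction_eqI, simp_all add: l_neg flip: r_distr)
    then show "\<exists>y\<in>carrier ?F. y \<oplus>\<^bsub>?F\<^esub> x = \<zero>\<^bsub>?F\<^esub>"
      using x by (intro bexI[of _ "fraction R S (\<ominus> a) s"]) auto
  qed
  show "comm_monoid ?F"
  proof (rule comm_monoidI)
    fix x y assume "x \<in> carrier ?F" "y \<in> carrier ?F"
    then show "x \<otimes>\<^bsub>?F\<^esub> y \<in> carrier ?F"
      by (elim fraction_cases) (simp add: fraction_mult)
  next
    show "\<one>\<^bsub>?F\<^esub> \<in> carrier ?F" by (simp add: fraction_one)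
  next
    fix x y z assume "x \<in> carrier ?F" "y \<in> carrier ?F" "z \<in> carrier ?F"
    then show "x \<otimes>\<^bsub>?F\<^esub> y \<otimes>\<^bsub>?F\<^esub> z = x \<otimes>\<^bsub>?F\<^esub> (y \<otimes>\<^bsub>?F\<^esub> z)"
      by (elim fraction_cases) (simp add: fraction_mult m_ac)
  next
    fix x assume "x \<in> carrier ?F"
    then show "\<one>\<^bsub>?F\<^esub> \<otimes>\<^bsub>?F\<^esub> x = x"
      by (elim fraction_cases) (simp add: fraction_mult fraction_one)
  next
    fix x y assume "x \<in> carrier ?F" "y \<in> carrier ?F"
    then show "x \<otimes>\<^bsub>?F\<^esub> y = y \<otimes>\<^bsub>?F\<^esub> x"
      by (elim fraction_cases) (simp add: fraction_mult m_ac)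
  qed
  show "(x \<oplus>\<^bsub>?F\<^esub> y) \<otimes>\<^bsub>?F\<^esub> z = x \<otimes>\<^bsub>?F\<^esub> z \<oplus>\<^bsub>?F\<^esub> y \<otimes>\<^bsub>?F\<^esub> z"
    if "x \<in> carrier ?F" "y \<in> carrier ?F" "z \<in> carrier ?F" for x y z
    using that
    by (elim fraction_cases)
      (simp add: fraction_add fraction_mult, rule fraction_eqI, simp_all add: m_ac l_distr r_distr)
qed

lemma ring_hom_fraction: "(\<lambda>a. fraction R S a \<one>) \<in> ring_hom R (ring_of_fractions R S)"
  by (rule ring_hom_memI) (simp_all add: fraction_mult fraction_add fraction_one)

end

lemma (in cring) ring_hom_cring_localization:
  assumes "primeideal P R"
  shows "ring_hom_cring R (localization R P) (localization_map R P)"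
proof -
  interpret P: primeideal P R by fact
  interpret multiplicative_subset R "carrier R - P"
  proof
    show "\<one> \<in> carrier R - P"
      using P.I_notcarr P.one_imp_carrier by auto
  qed (use P.I_prime in auto)
  show ?thesis
    using cring_ring_of_fractions ring_hom_fraction is_cring
    by (auto simp: localization_def localization_map_def[abs_def]
        intro!: ring_hom_cring.intro ring_hom_cring_axioms.intro)
qed


section \<open>Rational symbolic powers\<close>

text \<open>The conditions \<open>lower\<close> and \<open>upper\<close> together express \<open>c = \<lceil>p / q\<rceil>\<close> when \<open>q > 0\<close>.\<close>

lemma (in cring) localized_rational_power:
  assumes P: "primeideal P R" and I: "ideal I R"
    and red: "reduced_ring (associated_graded_ring (localization R P) (localized_ideal R P I))"
    and lower: "\<And>t. t < c \<Longrightarrow> t * q < p" and upper: "p \<le> c * q"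
  shows "localized_ideal R P (rational_power R I p q) = localized_ideal R P (ideal_power R I c)"
proof -
  let ?h = "localization_map R P"
  interpret h: ring_hom_cring R "localization R P" ?h
    using P by (rule ring_hom_cring_localization)
  let ?J = "localized_ideal R P I"
  have sub: "?h ` I \<subseteq> carrier (localization R P)"
    using ideal.Icarr[OF I] by auto
  have J: "ideal ?J (localization R P)" and hI: "?h ` I \<subseteq> ?J"
    unfolding localized_ideal_def
    using h.S.genideal_ideal[OF sub] h.S.genideal_self[OF sub] by auto
  have E: "ideal (localized_ideal R P (ideal_power R I c)) (localization R P)"
    unfolding localized_ideal_def
    using ideal_power_closed[OF I] by (intro h.S.genideal_ideal) auto
  have "?h f \<in> localized_ideal R P (ideal_power R I c)" if "f \<in> rational_power R I p q" for f
    using h.hom_rational_power[OF I hI that]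
      h.S.rational_power_subset_ideal_power[OF J red lower]
      h.ideal_power_extension_subset[OF I, of c]
    unfolding localized_ideal_def by blast
  then have "localized_ideal R P (rational_power R I p q)
      \<subseteq> localized_ideal R P (ideal_power R I c)"
    unfolding localized_ideal_def[of R P "rational_power R I p q"]
    by (intro h.S.genideal_minimal[OF E]) auto
  moreover have "localized_ideal R P (ideal_power R I c)
      \<subseteq> localized_ideal R P (rational_power R I p q)"
    unfolding localized_ideal_def
    using ideal_power_subset_rational_power[OF I upper]
    by (intro h.S.subset_Idl_subset) (auto simp: rational_power_def)
  ultimately show ?thesis by blast
qed

theorem theorem2p16:
  fixes R :: "('a, 'b) ring_scheme"
    and I :: "'a set"
    and u :: rat
    and p q :: nat
  assumes "cring R"
    and "noetherian_ring R"
    and "ideal I R"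
    and "p > 0" and "q > 0" and "u = of_nat p / of_nat q"
    and "Ass R I = minimal_primes R I"
    and "\<And>P. P \<in> Ass R I \<Longrightarrow>
           reduced_ring (associated_graded_ring (localization R P) (localized_ideal R P I))"
  shows "rational_symbolic_power R I p q = symbolic_power R I (nat \<lceil>u\<rceil>)"
proof -
  interpret cring R by fact
  let ?c = "nat \<lceil>u\<rceil>"
  have upper: "p \<le> ?c * q"
  proof -
    have "u * of_nat q \<le> of_nat ?c * of_nat q"
      by (intro mult_right_mono of_nat_ceiling) simp
    then have "of_nat p \<le> (of_nat (?c * q) :: rat)"
      using assms(5,6) by simp
    then show ?thesis by (simp only: of_nat_le_iff)
  qed
  have lower: "t * q < p" if "t < ?c" for t
  proof -
    have "of_nat t < u" using that by linarith
    then have "of_nat t * of_nat q < u * of_nat q"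
      using assms(5) by (intro mult_strict_right_mono) simp_all
    then have "of_nat (t * q) < (of_nat p :: rat)"
      using assms(5,6) by simp
    then show ?thesis by (simp only: of_nat_less_iff)
  qed
  have "localized_ideal R P (rational_power R I p q) = localized_ideal R P (ideal_power R I ?c)"
    if "P \<in> Ass R I" for P
    using that assms(8)
    by (intro localized_rational_power[OF _ assms(3) _ lower upper])
      (auto simp: Ass_def associated_primes_def)
  then show ?thesis
    by (simp add: rational_symbolic_power_def symbolic_power_def localized_ideal_preimage_def)
qed

end
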